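(* Let $n$ be a positive integer, let $k$ be an even divisor of $n$ with $\frac{n}{k}$ odd, put $q=2^k$, and let $l$ be a divisor of $k$. Let $S_1$ be a subset of $\mathbb{F}_{2^n}$ such that for every $x\in S_1$ one has $\mathrm{Tr}(x)=1$ and $\frac{x}{1+x}\in S_1$. Let $S=S_1\cup(\mathbb{F}_q\setminus\mathbb{F}_{2^l})$ or $S=\mathbb{F}_q\setminus\mathbb{F}_{2^l}$. Then the function $f(x)=x^{-1}+\delta_S(x)$ is a differentially 4-uniform permutation over $\mathbb{F}_{2^n}$ if one of the following holds: 1) $l$ is even; 2) $l=1$ and $k\equiv 2\pmod 4$; or 3) $l=3$ and $k=6$.
   Context: $\mathrm{Tr}(x)=\sum_{i=0}^{n-1}x^{2^i}$ is the absolute trace from $\mathbb{F}_{2^n}$ to $\mathbb{F}_2$. The convention $0^{-1}=0$ is used, so $x^{-1}=x^{2^n-2}$ on $\mathbb{F}_{2^n}$. For $S\subseteq\mathbb{F}_{2^n}$, $\delta_S:\mathbb{F}_{2^n}\to\mathbb{F}_2\subseteq\mathbb{F}_{2^n}$ is the characteristic function: $\delta_S(x)=1$ if $x\in S$ and $\delta_S(x)=0$ otherwise. For $f:\mathbb{F}_{2^n}\to\mathbb{F}_{2^n}$, the differential uniformity is $\Delta_f=\max\{N(a,b): a,b\in\mathbb{F}_{2^n}, a\neq 0\}$, where $N(a,b)$ is the number of $x\in\mathbb{F}_{2^n}$ with $f(x+a)+f(x)=b$. $f$ is differentially 4-uniform if $\Delta_f=4$. *)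

theory Defs
  imports "HOL-Algebra.Algebraic_Closure_Type" "HOL-Library.Indicator_Function" "HOL-Library.Cardinality"
begin

text \<open>The field with \<open>2 ^ n\<close> elements is rendered as a type of sort \<open>{field, finite}\<close> with
  \<open>CARD('a) = 2 ^ n\<close>; the class law \<open>inverse 0 = 0\<close> is the convention for inversion at zero.\<close>

text \<open>The absolute trace to the prime field, whose elements are \<open>0\<close> and \<open>1\<close> of the ambient field;
  \<open>n\<close> is the degree of the ambient field over the prime field.\<close>

definition abs_trace :: "nat \<Rightarrow> 'a::field \<Rightarrow> 'a" where
  "abs_trace n x = (\<Sum>i<n. x ^ (2 ^ i))"

definition diff_count :: "('a::{field, finite} \<Rightarrow> 'a) \<Rightarrow> 'a \<Rightarrow> 'a \<Rightarrow> nat" where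
  "diff_count f a b = card {x. f (x + a) + f x = b}"

definition diff_uniformity :: "('a::{field, finite} \<Rightarrow> 'a) \<Rightarrow> nat" where
  "diff_uniformity f = Max {diff_count f a b | a b. a \<noteq> 0}"

definition diff_4_uniform :: "('a::{field, finite} \<Rightarrow> 'a) \<Rightarrow> bool" where
  "diff_4_uniform f \<longleftrightarrow> diff_uniformity f = 4"

text \<open>\<open>K\<close> is a subfield of order \<open>m\<close> of the ambient field \<open>'a\<close>. A finite field has at most one
  subfield of each order, so this determines \<open>K\<close>.\<close>

definition subfield_of_order :: "nat \<Rightarrow> 'a::{field, finite} set \<Rightarrow> bool" where
  "subfield_of_order m K \<longleftrightarrow> subfield K (ring_of_type_algebra :: 'a ring) \<and> card K = m"

end

theory Submission
  imports Defs
begin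

text \<open>For \<open>a \<noteq> 0\<close> and \<open>a c \<noteq> 1\<close> the equation \<open>1/(x + a) + 1/x = c\<close> has at most two solutions
  \<open>x, x + a\<close>; for \<open>c = 1/a\<close> it has the four solutions \<open>0, a, a w, a w + a\<close> with \<open>w\<close> a primitive cube
  root of unity. As \<open>\<delta>\<^sub>S\<close> takes the values 0 and 1, more than four solutions of the differential
  equation of \<open>f\<close> can only arise when the four special solutions are joined by a pair \<open>x, x + a\<close> with
  \<open>1/a + 1/x + 1/(x + a) = 1\<close>. For such a triple \<open>{a, x, x + a}\<close> every member \<open>u\<close> makes \<open>1/(1 + u)\<close> of the
  form \<open>y\<^sup>2 + y\<close>, so \<open>1/(1 + u)\<close> has trace 0 and \<open>u \<notin> S\<^sub>1\<close>; moreover the triple lies in \<open>Fq\<close> as soon as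
  one member does. Hence \<open>S\<^sub>1\<close> is irrelevant on the triple, and the three conditions on \<open>l\<close> exclude the
  remaining coincidences. The value 4 is attained at \<open>a = b = 1\<close>.\<close>

section \<open>Finite fields: subfields as root sets, and the characteristic\<close>

lemma subfield_order_eq_roots:
  assumes "subfield_of_order m (K :: 'a::{field, finite} set)"
  shows "K = {x. x ^ m = x}"
proof -
  let ?R = "ring_of_type_algebra :: 'a ring"
  let ?K = "?R\<lparr>carrier := K\<rparr>"
  have sf: "subfield K ?R" and card: "card K = m"
    using assms by (auto simp: subfield_of_order_def)
  interpret R: field ?R by (rule field_from_type_algebra)
  interpret K: field ?K using R.subfield_iff(2)[OF sf] .
  have 0: "0 \<in> K" and 1: "1 \<in> K"
    using K.zero_closed K.one_closed by (auto simp: ring_of_type_algebra_def)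
  have m: "m > 1"
    using card_mono[of K "{0,1}"] 0 1 card by auto
  have pow: "x [^]\<^bsub>?K\<^esub> (j::nat) = x ^ j" for x j
    by (induction j) (auto simp: ring_of_type_algebra_def mult.commute)
  have units: "Units ?K = K - {0}"
    using subfield.subfield_Units[OF sf] by (simp add: ring_of_type_algebra_def)
  have sub: "x ^ m = x" if "x \<in> K" for x
  proof (cases "x = 0")
    case False
    then have "x [^]\<^bsub>?K\<^esub> card (Units ?K) = \<one>\<^bsub>?K\<^esub>"
      using that units by (intro K.units_power_order_eq_one) auto
    then have "x ^ (m - 1) = 1"
      using 0 card by (simp add: pow units) (simp add: ring_of_type_algebra_def)
    then show ?thesis
      using m by (metis Suc_diff_1 mult.right_neutral power_Suc less_trans zero_less_one)
  qed (use m in auto)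
  \<comment> \<open>Lagrange in the unit group of \<open>K\<close> has put \<open>K\<close> inside
    the root set of X^m - X. This polynomial has at most \<open>m = card K\<close> roots, so the
    inclusion is an equality.\<close>
  let ?p = "monom 1 m - monom 1 1 :: 'a poly"
  have "coeff ?p m = 1" using m by simp
  then have "?p \<noteq> 0" by (metis coeff_0 zero_neq_one)
  then have "card {x. poly ?p x = 0} \<le> degree ?p" by (rule card_poly_roots_bound)
  also have "degree ?p \<le> m" using m by (intro degree_diff_le) (auto simp: degree_monom_eq)
  finally have "card {x::'a. x ^ m = x} \<le> m" by (simp add: poly_monom)
  then show "K = {x. x ^ m = x}"
    using sub card by (intro card_seteq) auto
qed

lemma pow_card_eq_self:
  fixes x :: "'a::{field, finite}"
  shows "x ^ CARD('a) = x"
proof -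
  interpret R: field "ring_of_type_algebra :: 'a ring" by (rule field_from_type_algebra)
  have "subfield_of_order CARD('a) (UNIV :: 'a set)"
    using R.carrier_is_subfield by (simp add: subfield_of_order_def ring_of_type_algebra_def)
  from subfield_order_eq_roots[OF this] show ?thesis by auto
qed

lemma CHAR_eq_2:
  assumes "CARD('a::{field, finite}) = 2 ^ n" "n > 0"
  shows "CHAR('a) = 2"
proof -
  have "(- 1 :: 'a) = 1"
    using pow_card_eq_self[of "-1 :: 'a"] assms by simp
  then have "(2 :: 'a) = 0"
    by (metis add.right_inverse one_add_one)
  then have "of_nat 2 = (0 :: 'a)" by simp
  then have "CHAR('a) dvd 2" by (simp only: of_nat_eq_0_iff_char_dvd)
  then show ?thesis
    by (metis CHAR_not_1 One_nat_def prime_nat_iff two_is_prime_nat)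
qed

section \<open>Characteristic 2: arithmetic, trace and Artin-Schreier equations\<close>

context
  assumes char2: "CHAR('a::field) = 2"
begin

lemma add_self: "(x::'a) + x = 0"
  using minus_CHAR_2[OF char2, of x x] by simp

lemma add_self_left: "(x::'a) + (x + y) = y"
  by (simp add: add.assoc [symmetric] add_self)

lemma add_eq_0_iff_eq: "(x::'a) + y = 0 \<longleftrightarrow> x = y"
  using minus_CHAR_2[OF char2, of x y] by (metis eq_iff_diff_eq_0)

lemma add_eq_iff: "(x::'a) + y = z \<longleftrightarrow> x = z + y"
  using minus_CHAR_2[OF char2, of z y] by (metis eq_diff_eq)

lemma pow_two_pow_add: "((x::'a) + y) ^ (2 ^ m) = x ^ (2 ^ m) + y ^ (2 ^ m)"
  by (rule freshmans_dream') (auto simp: char2)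

lemma pow2_add: "((x::'a) + y)\<^sup>2 = x\<^sup>2 + y\<^sup>2"
  using pow_two_pow_add[of x y 1] by simp

lemmas char2_simps = add_self add_self_left ring_distribs add_ac mult_ac

lemma of_nat_char2: "(of_nat j :: 'a) = (if even j then 0 else 1)"
  by (induction j) (auto simp: add_self)

lemma quadratic_roots:
  assumes "(x::'a)\<^sup>2 + x = y\<^sup>2 + y"
  shows "y = x \<or> y = x + 1"
proof -
  have "(x + y) * (x + y + 1) = (x\<^sup>2 + x) + (y\<^sup>2 + y)"
    by (simp add: char2_simps power2_eq_square)
  also have "\<dots> = 0" by (simp add: assms add_self)
  finally show ?thesis
    by (metis add.commute add_eq_iff add_eq_0_iff_eq mult_eq_0_iff add.right_neutral)
qed

lemma abs_trace_add: "abs_trace n ((x::'a) + y) = abs_trace n x + abs_trace n y"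
  by (simp add: abs_trace_def pow_two_pow_add sum.distrib)

lemma abs_trace_1: "even n \<Longrightarrow> abs_trace n (1::'a) = 0"
  by (simp add: abs_trace_def of_nat_char2)

text \<open>The sum telescopes. When \<open>2 ^ n\<close> is the order of the field, the right side
  vanishes, so elements of the form \<open>y\<^sup>2 + y\<close> have trace 0.\<close>

lemma abs_trace_sq_add: "abs_trace n ((y::'a)\<^sup>2 + y) = y ^ (2 ^ n) + y"
proof (induction n)
  case 0
  then show ?case by (simp add: abs_trace_def add_self)
next
  case (Suc n)
  have "abs_trace (Suc n) (y\<^sup>2 + y) = abs_trace n (y\<^sup>2 + y) + (y\<^sup>2 + y) ^ (2 ^ n)"
    by (simp add: abs_trace_def)
  also have "(y\<^sup>2 + y) ^ (2 ^ n) = y ^ (2 ^ Suc n) + y ^ (2 ^ n)"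
    by (simp add: pow_two_pow_add flip: power_mult)
  finally show ?case unfolding Suc.IH by (simp only: char2_simps)
qed

text \<open>Clearing denominators turns the hypothesis into
  \<open>(1 + u) * (v\<^sup>2 + u * v) = u\<^sup>2\<close>, which is then divided by
  \<open>u\<^sup>2\<close> and \<open>1 + u\<close>. The hypothesis is symmetric in
  \<open>u\<close>, \<open>v\<close>, \<open>u + v\<close>, so the result applies to each member of
  the triple.\<close>

lemma triple_artin_schreier:
  assumes "(u::'a) \<noteq> 0" "v \<noteq> 0" "u \<noteq> v"
    and "inverse u + inverse v + inverse (u + v) = 1"
  shows "u \<noteq> 1" and "(v / u)\<^sup>2 + v / u = inverse (1 + u)"
proof -
  have ne: "u + v \<noteq> 0" using assms by (simp add: add_eq_0_iff_eq)
  have "u * v * (u + v) = u * v * (u + v) * (inverse u + inverse v + inverse (u + v))"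
    using assms(4) by simp
  also have "\<dots> = v * (u + v) + u * (u + v) + u * v"
  proof -
    have "u * v * s * (inverse u + inverse v + inverse s) = v * s + u * s + u * v"
      if "s \<noteq> 0" for s
      using assms(1,2) that by (simp add: field_simps)
    then show ?thesis using ne by blast
  qed
  also have "\<dots> = u\<^sup>2 + u * v + v\<^sup>2"
    by (simp add: char2_simps power2_eq_square)
  finally have *: "(1 + u) * (v\<^sup>2 + u * v) = u\<^sup>2"
    by (simp add: char2_simps power2_eq_square add_eq_iff)
  with assms(1) have "1 + u \<noteq> 0" by auto
  then show "u \<noteq> 1" by (simp add: add_eq_0_iff_eq)
  have "(v / u)\<^sup>2 + v / u = (v\<^sup>2 + u * v) / u\<^sup>2"
    using assms(1) by (simp add: field_simps power2_eq_square)
  also have "\<dots> = inverse (1 + u)"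
    using * \<open>1 + u \<noteq> 0\<close> assms(1) by (simp add: field_simps)
  finally show "(v / u)\<^sup>2 + v / u = inverse (1 + u)" .
qed

text \<open>If \<open>y\<^sup>2 + y\<close> lies in the field of \<open>2 ^ k\<close> elements, then \<open>y ^ (2 ^ k) + y\<close> is \<open>0\<close> or \<open>1\<close>, and
  an odd number of applications of the \<open>2 ^ k\<close>-Frobenius leaves \<open>y\<close> unchanged only in the first case.\<close>

lemma artin_schreier_root_in_subfield:
  assumes "((y::'a)\<^sup>2 + y) ^ (2 ^ k) = y\<^sup>2 + y" and "odd m" and "y ^ (2 ^ (k * m)) = y"
  shows "y ^ (2 ^ k) = y"
proof -
  let ?z = "y ^ (2 ^ k)"
  have "?z\<^sup>2 + ?z = y\<^sup>2 + y"
    using assms(1) by (simp add: pow_two_pow_add mult.commute flip: power_mult)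
  then have "?z = y \<or> ?z = y + 1"
    using quadratic_roots by metis
  moreover have False if z: "?z = y + 1"
  proof -
    have "y ^ (2 ^ (k * j)) = y + of_nat j" for j
    proof (induction j)
      case (Suc j)
      have "y ^ (2 ^ (k * Suc j)) = (y ^ (2 ^ (k * j))) ^ (2 ^ k)"
        by (simp add: power_add mult.commute flip: power_mult)
      also have "\<dots> = ?z + of_nat j ^ (2 ^ k)"
        by (simp add: Suc.IH pow_two_pow_add)
      also have "of_nat j ^ (2 ^ k) = (of_nat j :: 'a)"
        by (cases "even j") (auto simp: of_nat_char2)
      finally show ?case using z by (simp add: add_ac)
    qed simp
    with assms(3) have "(of_nat m :: 'a) = 0" by (metis add_cancel_left_right)
    with assms(2) show False by (simp add: of_nat_char2)
  qed
  ultimately show ?thesis by blast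
qed

text \<open>Since \<open>w\<close> has order 3, it is fixed by the fourth power, whereas
  \<open>y ^ 4 = y + (w\<^sup>2 + w) = y + 1\<close>. A root in the field of
  \<open>2 ^ (2 * m)\<close> elements would descend to the field of 4 elements, where
  \<open>y ^ 4 = y\<close>.\<close>

lemma no_artin_schreier_root_omega:
  assumes "(w::'a)\<^sup>2 + w = 1" and "y\<^sup>2 + y = w" and "odd m"
  shows "y ^ (2 ^ (2 * m)) \<noteq> y"
proof
  have y2: "y\<^sup>2 = y + w" using assms(2) by (metis add_eq_iff add.commute)
  have "y ^ 4 = (y\<^sup>2)\<^sup>2" by simp
  also have "\<dots> = y + (w\<^sup>2 + w)" by (simp add: y2 pow2_add add_ac)
  finally have y4: "y ^ (2 ^ 2) = y + 1" using assms(1) by simp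
  have "w\<^sup>2 = w + 1" using assms(1) by (metis add_eq_iff add.commute)
  then have "w ^ 4 = w"
    using power_mult[of w 2 2] by (simp add: pow2_add add_self_left add.commute)
  moreover assume "y ^ (2 ^ (2 * m)) = y"
  ultimately have "y ^ (2 ^ 2) = y"
    using assms(2,3) by (intro artin_schreier_root_in_subfield[of y 2 m]) auto
  then show False using y4 by simp
qed


text \<open>With \<open>d = y ^ 8 + y\<close>, which lies in the field of 8 elements, \<open>d\<^sup>2 + d\<close> equals \<open>c / (1 + c + c\<^sup>2)\<close>.
  The former has trace 0 over the prime field, the latter trace 1.\<close>

lemma no_artin_schreier_root_GF64:
  assumes w: "(w::'a)\<^sup>2 + w = 1" and c: "c ^ 8 = c" "c \<noteq> 0"
    and y: "y\<^sup>2 + y = inverse (1 + c * w)"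
  shows "y ^ 64 \<noteq> y"
proof
  assume y64: "y ^ 64 = y"
  have pow8: "((x::'a) + x') ^ 8 = x ^ 8 + x' ^ 8" and pow4: "(x + x') ^ 4 = x ^ 4 + x' ^ 4" for x x'
    using pow_two_pow_add[of x x' 3] pow_two_pow_add[of x x' 2] by auto
  have w2: "w\<^sup>2 = w + 1" using w by (metis add_eq_iff add.commute)
  then have w4: "w ^ 4 = w"
    using power_mult[of w 2 2] by (simp add: pow2_add add_self_left add.commute)
  have w8: "w ^ 8 = w + 1"
    using power_mult[of w 4 2] by (simp add: w4 w2)
  have c7: "c * (c * (c * (c * (c * (c * c))))) = 1"
    using c by (simp add: eval_nat_numeral)
  \<comment> \<open>\<open>D\<close> is the norm of \<open>1 + c * w\<close> from 64 to 8 elements: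
    the eighth power fixes \<open>c\<close> and sends \<open>w\<close> to
    \<open>w + 1\<close>.\<close>
  define D where "D = 1 + c + c\<^sup>2"
  have D: "(1 + c * w) * (1 + c * (w + 1)) = D"
  proof -
    have "(1 + c * w) * (1 + c * (w + 1)) = 1 + c + c\<^sup>2 * (w\<^sup>2 + w)"
      by (simp add: char2_simps power2_eq_square)
    then show ?thesis by (simp add: w D_def)
  qed
  \<comment> \<open>This is \<open>v + v\<^sup>2 + v ^ 4 = 1\<close> for \<open>v = c / D\<close>,
    multiplied by \<open>D ^ 4\<close>: the trace of \<open>v\<close> is 1.\<close>
  have "c * D ^ 3 + c\<^sup>2 * D\<^sup>2 + c ^ 4 + D ^ 4 = 0"
    unfolding D_def by (simp add: eval_nat_numeral char2_simps c7)
  \<comment> \<open>A zero of \<open>D\<close> would be a primitive cube root of unity, impossible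
    for an element with \<open>c ^ 7 = 1\<close>.\<close>
  have D0: "D \<noteq> 0"
  proof
    assume "D = 0"
    have "c ^ 3 + 1 = (c + 1) * D"
      by (simp add: D_def char2_simps eval_nat_numeral)
    with \<open>D = 0\<close> have c3: "c ^ 3 = 1" by (simp add: add_eq_0_iff_eq)
    have "c ^ 8 = c ^ 3 * c ^ 3 * c\<^sup>2" by (simp flip: power_add)
    then have "c = 1" using c c3 by (simp add: power2_eq_square)
    with \<open>D = 0\<close> show False by (simp add: D_def add_self)
  qed
  define v where "v = c / D"
  define d where "d = y ^ 8 + y"
  have "d ^ 8 = d"
    using y64 by (simp add: d_def pow8 add.commute flip: power_mult)
  have "d\<^sup>2 + d = (y\<^sup>2 + y) ^ 8 + (y\<^sup>2 + y)"
    by (simp add: d_def pow8 pow2_add add_ac flip: power_mult)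
  also have "\<dots> = inverse (1 + c * (w + 1)) + inverse (1 + c * w)"
    by (simp add: y pow8 power_inverse power_mult_distrib c w8)
  also have "\<dots> = ((1 + c * w) + (1 + c * (w + 1))) / D"
  proof -
    have "inverse r + inverse p = (p + r) / (p * r)" if "p * r \<noteq> 0" for p r :: 'a
      using that by (simp add: field_simps)
    then show ?thesis using D0 unfolding D [symmetric] by blast
  qed
  also have "(1 + c * w) + (1 + c * (w + 1)) = c"
    by (simp add: char2_simps)
  finally have v: "v = d\<^sup>2 + d" by (simp add: v_def)
  have "v + v\<^sup>2 + v ^ 4 = d + d ^ 8"
    by (simp add: v pow2_add pow4 char2_simps flip: power_mult)
  then have "v + v\<^sup>2 + v ^ 4 = 0"
    using \<open>d ^ 8 = d\<close> by (simp add: add_self)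
  moreover have "D ^ 4 * (v + v\<^sup>2 + v ^ 4) = c * D ^ 3 + c\<^sup>2 * D\<^sup>2 + c ^ 4"
    using D0 by (simp add: v_def field_simps eval_nat_numeral)
  moreover have "c * D ^ 3 + c\<^sup>2 * D\<^sup>2 + c ^ 4 = D ^ 4"
    using \<open>c * D ^ 3 + c\<^sup>2 * D\<^sup>2 + c ^ 4 + D ^ 4 = 0\<close> by (simp add: add_eq_0_iff_eq)
  ultimately show False using D0 by simp
qed

section \<open>Differential equation of inversion\<close>

lemma inverse_difference_solutions:
  assumes "(a::'a) \<noteq> 0" "a * c \<noteq> 1"
    and "inverse (z + a) + inverse z = c" "inverse (x + a) + inverse x = c"
  shows "x = z \<or> x = z + a"
proof -
  \<comment> \<open>As \<open>a * c \<noteq> 1\<close>, neither 0 nor \<open>a\<close> is a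
    solution, so denominators can be cleared and a quadratic equation remains.\<close>
  have *: "u \<noteq> 0 \<and> u + a \<noteq> 0 \<and> a = c * (u * (u + a))" if "inverse (u + a) + inverse u = c" for u
  proof -
    have "u \<noteq> 0" using that assms(1,2) by auto
    moreover have "u + a \<noteq> 0"
    proof
      assume "u + a = 0"
      then have "inverse u = c" using that by (metis add_0 inverse_zero)
      moreover have "u = a" using \<open>u + a = 0\<close> by (simp only: add_eq_0_iff_eq)
      ultimately have "inverse a = c" by simp
      with assms(1,2) show False by auto
    qed
    moreover have "u * s * (inverse s + inverse u) = u + s" if "s \<noteq> 0" for s
      using \<open>u \<noteq> 0\<close> that by (simp add: field_simps)
    ultimately have "u * (u + a) * c = u + (u + a)" using that by metis
    then show ?thesis using \<open>u \<noteq> 0\<close> \<open>u + a \<noteq> 0\<close> by (simp add: add_self_left mult_ac)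
  qed
  have "c \<noteq> 0" using *[OF assms(3)] assms(1) by auto
  have "c * (x * (x + a)) = c * (z * (z + a))"
    using *[OF assms(3)] *[OF assms(4)] by metis
  with \<open>c \<noteq> 0\<close> have "x * (x + a) = z * (z + a)" by simp
  moreover have "(x + z) * (x + (z + a)) = x * (x + a) + z * (z + a)"
    by (simp add: char2_simps)
  ultimately have "(x + z) * (x + (z + a)) = 0" by (simp add: add_self)
  then show ?thesis by (simp add: add_eq_0_iff_eq)
qed

text \<open>Away from 0 and \<open>a\<close> the equation reads
  \<open>x * (x + a) = a\<^sup>2\<close>, so \<open>x / a\<close> is a root of
  \<open>t\<^sup>2 + t = 1\<close>, that is \<open>w\<close> or \<open>w + 1\<close>.\<close>

lemma inverse_difference_special_solutions:
  assumes "(w::'a)\<^sup>2 + w = 1" "a \<noteq> 0" "inverse (x + a) + inverse x = inverse a"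
  shows "x \<in> {0, a, a * w, a * w + a}"
proof (cases "x = 0 \<or> x = a")
  case False
  then have ne: "x \<noteq> 0" "x + a \<noteq> 0" by (auto simp: add_eq_0_iff_eq)
  have "a * x * s * (inverse s + inverse x) = a * (x + s)"
    and "a * x * s * inverse a = x * s" if "s \<noteq> 0" for s
    using assms(2) ne(1) that by (simp_all add: field_simps)
  from this[OF ne(2)] have "x * (x + a) = a\<^sup>2"
    using assms(3) by (simp add: add_self_left power2_eq_square)
  then have "(x / a)\<^sup>2 + x / a = 1"
    using assms(2) by (simp add: field_simps power2_eq_square)
  then have "x / a = w \<or> x / a = w + 1"
    using quadratic_roots[of w "x / a"] assms(1) by simp
  then show ?thesis using assms(2) by (auto simp: field_simps)
qed auto

end

section \<open>Bounding the solution counts by 4\<close>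

lemma card_union_le_4:
  assumes "card A \<le> 2" "card B \<le> 2"
  shows "card (A \<union> B) \<le> 4"
  using card_Un_le[of A B] assms by simp

text \<open>Solutions are sorted by whether the indicator differs at \<open>x\<close> and
  \<open>x + a\<close>. The premise \<open>key\<close> collects what must be known about
  \<open>S\<close>: if the indicator treats both special pairs alike, it treats a further pair
  \<open>x, x + a\<close> the same way, so the three pairs never count together.\<close>

lemma diff_count_le_4:
  fixes a b w :: "'a::{field, finite}"
  assumes char2: "CHAR('a) = 2" and w: "w\<^sup>2 + w = 1" and S0: "0 \<notin> S" and a: "a \<noteq> 0"
    and key: "\<And>x. x \<noteq> 0 \<Longrightarrow> x \<noteq> a \<Longrightarrow> a \<noteq> 1 \<Longrightarrow>
        inverse (x + a) + inverse x + inverse a = 1 \<Longrightarrow>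
        a \<in> S \<longleftrightarrow> ((a * w \<in> S) \<noteq> (a * w + a \<in> S)) \<Longrightarrow>
        a \<in> S \<longleftrightarrow> ((x \<in> S) \<noteq> (x + a \<in> S))"
  shows "diff_count (\<lambda>x. inverse x + indicator S x) a b \<le> 4"
proof -
  define g where "g x = inverse (x + a) + inverse x" for x
  define d where "d x \<longleftrightarrow> ((x \<in> S) \<noteq> (x + a \<in> S))" for x
  define T where "T = {x. g x = (if d x then b + 1 else b)}"
  note c2 = add_self[OF char2] add_self_left[OF char2]
  have "inverse (x + a) + indicator S (x + a) + (inverse x + indicator S x)
      = g x + (if d x then 1 else 0)" for x
    by (auto simp: g_def d_def indicator_def c2 add_ac)
  moreover have "z + 1 = b \<longleftrightarrow> z = b + 1" for z
    by (rule add_eq_iff[OF char2])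
  ultimately have T: "diff_count (\<lambda>x. inverse x + indicator S x) a b = card T"
    unfolding diff_count_def T_def by (intro arg_cong[where f = card]) auto
  have pair: "card {x. g x = c} \<le> 2" if "a * c \<noteq> 1" for c
  proof (cases "\<exists>z. g z = c")
    case True
    then obtain z where "g z = c" by blast
    then have "{x. g x = c} \<subseteq> {z, z + a}"
      using inverse_difference_solutions[OF char2 a that, of z] by (auto simp: g_def)
    then have "card {x. g x = c} \<le> card {z, z + a}" by (intro card_mono) auto
    also have "\<dots> \<le> 2" by (simp add: card_insert_if)
    finally show ?thesis .
  qed auto
  show ?thesis
  proof (cases "a * b \<noteq> 1 \<and> a * (b + 1) \<noteq> 1")
    case True
    have "card T \<le> card ({x. g x = b} \<union> {x. g x = b + 1})"
      by (intro card_mono) (auto simp: T_def)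
    also have "\<dots> \<le> 4" using True by (intro card_union_le_4 pair) auto
    finally show ?thesis using T by simp
  next
    case False
    define c where "c = inverse a"
    \<comment> \<open>With the flag \<open>e\<close>, both critical values of \<open>b\<close> are
      handled at once: a special solution counts exactly when \<open>d x = e\<close>.\<close>
    obtain e where b: "b = (if e then c + 1 else c)"
    proof (cases "a * b = 1")
      case True
      then have "b = c" using a by (simp add: c_def field_simps)
      then show ?thesis using that[of False] by simp
    next
      case ne: False
      with False have "b + 1 = c" using a by (simp add: c_def field_simps)
      then show ?thesis using that[of True] by (metis add_eq_iff[OF char2])
    qed
    have mem_T: "x \<in> T \<longleftrightarrow> g x = (if d x = e then c else c + 1)" for x
      by (auto simp: T_def b c2 add.assoc)
    have special: "x \<in> {0, a, a * w, a * w + a}" if "g x = c" for x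
      using inverse_difference_special_solutions[OF char2 w a] that by (simp add: g_def c_def)
    show ?thesis
    proof (cases "\<exists>z\<in>T. g z = c + 1")
      case False
      then have "T \<subseteq> {0, a, a * w, a * w + a}"
        using special mem_T by (metis subsetI)
      then have "card T \<le> card {0, a, a * w, a * w + a}" by (intro card_mono) auto
      also have "\<dots> \<le> 4" by (simp add: card_insert_if)
      finally show ?thesis using T by simp
    next
      case True
      then obtain z where z: "z \<in> T" "g z = c + 1" by blast
      then have dz: "d z \<noteq> e" by (auto simp: mem_T split: if_splits)
      have z0: "z \<noteq> 0" "z \<noteq> a"
        using z(2) by (auto simp: g_def c_def c2)
      have "a \<noteq> 1"
      proof
        assume "a = 1"
        then have "inverse (z + a) = inverse z"
          using z(2) by (simp add: g_def c_def c2 add_eq_0_iff_eq[OF char2])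
        then show False using a by simp
      qed
      have "inverse (z + a) + inverse z + inverse a = 1"
        using z(2) by (simp add: g_def c_def add_ac c2)
      note k = key[OF z0 \<open>a \<noteq> 1\<close> this]
      have d0: "d 0 \<longleftrightarrow> a \<in> S" "d a \<longleftrightarrow> a \<in> S" using S0 by (auto simp: d_def c2)
      have dw: "d (a * w + a) \<longleftrightarrow> d (a * w)" by (auto simp: d_def c2 add.assoc)
      \<comment> \<open>If both equalities held, \<open>key\<close> would give
        \<open>d z = d 0 = e\<close>, against \<open>dz\<close>. Hence at most one special pair
        survives; it is contained in \<open>P\<close>.\<close>
      have "d 0 \<noteq> e \<or> d (a * w) \<noteq> e"
        using k dz d0 by (auto simp: d_def)
      define P where "P = (if d 0 = e then {0, a} else {a * w, a * w + a})"
      have P: "card P \<le> 2" by (simp add: P_def card_insert_if)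
      have in_P: "x \<in> P" if "x \<in> {0, a, a * w, a * w + a}" "d x = e" for x
        using that \<open>d 0 \<noteq> e \<or> d (a * w) \<noteq> e\<close> d0 dw by (auto simp: P_def)
      have "T \<subseteq> {x. g x = c + 1} \<union> P"
      proof
        fix x assume "x \<in> T"
        then have "g x = c \<and> d x = e \<or> g x = c + 1" by (simp add: mem_T split: if_splits)
        then show "x \<in> {x. g x = c + 1} \<union> P" using special in_P by blast
      qed
      then have "card T \<le> card ({x. g x = c + 1} \<union> P)" by (intro card_mono) auto
      also have "\<dots> \<le> 4"
        using P a by (intro card_union_le_4 pair) (auto simp: c_def field_simps)
      finally show ?thesis using T by simp
    qed
  qed
qed

section \<open>Injectivity, and existence of cube roots of unity\<close>

lemma inj_inverse_add_indicator:
  fixes S :: "'a::field set"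
  assumes char2: "CHAR('a) = 2" and "0 \<notin> S" "1 \<notin> S" and S: "\<And>x. x \<in> S \<Longrightarrow> x / (1 + x) \<in> S"
  shows "inj (\<lambda>x. inverse x + indicator S x)"
proof (rule injI)
  \<comment> \<open>Such a collision forces \<open>y = x / (1 + x)\<close>, which the closure of
    \<open>S\<close> puts into \<open>S\<close>.\<close>
  have *: False if "x \<in> S" "y \<notin> S" "inverse x + 1 = inverse y" for x y
  proof -
    have "x \<noteq> 0" "1 + x \<noteq> 0"
      using that assms(2,3) add_eq_0_iff_eq[OF char2, of 1 x] by auto
    then have "x / (1 + x) = inverse (inverse x + 1)" by (simp add: field_simps)
    with that S[of x] show False by simp
  qed
  fix x y assume "inverse x + indicator S x = inverse y + (indicator S y :: 'a)"
  then show "x = y"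
    using *[of x y] *[of y x] by (cases "x \<in> S"; cases "y \<in> S") auto
qed

text \<open>The order of the field is a power of 4, hence \<open>3 * m + 1\<close>. Some nonzero
  \<open>x\<close> is not a root of X^m - 1, and then \<open>x ^ m\<close> is a primitive cube root
  of unity.\<close>

lemma ex_cube_root_unity:
  assumes "CARD('a::{field, finite}) = 2 ^ n" "n > 0" "even n"
  obtains w :: "'a::{field, finite}" where "w\<^sup>2 + w = 1"
proof -
  have char2: "CHAR('a) = 2" using CHAR_eq_2 assms by blast
  obtain j where j: "n = 2 * j" "j > 0" using assms by (auto elim: evenE)
  have "\<exists>m. (4::nat) ^ i = 3 * m + 1" for i by (induction i) (auto, presburger)
  then obtain m :: nat where "4 ^ j = 3 * m + 1" by blast
  moreover have "(4::nat) ^ j \<ge> 4 ^ 1" using j by (intro power_increasing) auto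
  ultimately have m: "CARD('a) = 3 * m + 1" "m > 0"
    using assms(1) j by (auto simp: power_mult)
  let ?p = "monom 1 m - 1 :: 'a poly"
  have "degree ?p \<le> m" by (intro degree_diff_le) (auto simp: degree_monom_eq)
  moreover have "coeff ?p m = 1" using m by simp
  then have "?p \<noteq> 0" by (metis coeff_0 zero_neq_one)
  ultimately have "card {x. poly ?p x = 0} \<le> m" using card_poly_roots_bound[of ?p] by simp
  then have "card (insert 0 {x. poly ?p x = 0}) < CARD('a)"
    using m by (simp add: card_insert_if)
  then have "insert 0 {x. poly ?p x = 0} \<noteq> UNIV" by (metis less_irrefl)
  then obtain x where "x \<notin> insert 0 {x. poly ?p x = 0}" by blast
  then have x: "x \<noteq> 0" "x ^ m \<noteq> 1" by (auto simp: poly_monom)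
  define v where "v = x ^ m"
  have "v ^ 3 * x = x" using pow_card_eq_self[of x] by (simp add: v_def m mult.commute flip: power_mult)
  then have "v ^ 3 = 1" using x by simp
  have "(v + 1) * (v\<^sup>2 + v + 1) = v ^ 3 + 1"
    by (simp add: eval_nat_numeral char2_simps[OF char2])
  also have "\<dots> = 0" by (simp add: \<open>v ^ 3 = 1\<close> add_self[OF char2])
  finally have "v\<^sup>2 + v = 1"
    using x by (simp add: v_def add_eq_0_iff_eq[OF char2])
  then show ?thesis using that by blast
qed

theorem theorem5:
  fixes n k l :: nat
    and Fq Fl S1 S :: "'a::{field, finite} set"
  assumes "n > 0" and "CARD('a) = 2 ^ n"
    and "even k" and "k dvd n" and "odd (n div k)" and "l dvd k"
    and "subfield_of_order (2 ^ k) Fq" and "subfield_of_order (2 ^ l) Fl"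
    and "\<forall>x\<in>S1. abs_trace n x = 1 \<and> x / (1 + x) \<in> S1"
    and "S = S1 \<union> (Fq - Fl) \<or> S = Fq - Fl"
    and "even l \<or> (l = 1 \<and> k mod 4 = 2) \<or> (l = 3 \<and> k = 6)"
  shows "bij (\<lambda>x::'a. inverse x + indicator S x) \<and>
         diff_4_uniform (\<lambda>x::'a. inverse x + indicator S x)"
proof -
  let ?f = "\<lambda>x::'a. inverse x + indicator S x"
  have "even n" using assms(3,4) by (rule dvd_trans)
  obtain m where nm: "n = k * m" "odd m" using assms(1,4,5) by auto
  have char2: "CHAR('a) = 2" using CHAR_eq_2 assms(1,2) by blast
  note c2 = add_self[OF char2] add_self_left[OF char2]
  note eq_iff = add_eq_0_iff_eq[OF char2]
  have pow_n: "x ^ (2 ^ n) = x" for x :: 'a using pow_card_eq_self[of x] assms(2) by simp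
  have pow_km: "x ^ (2 ^ (k * m)) = x" for x :: 'a using pow_n[of x] nm(1) by simp
  obtain w :: 'a where w: "w\<^sup>2 + w = 1" using ex_cube_root_unity[of n, where 'a = 'a] assms(1,2) \<open>even n\<close> by blast
  have w2: "w\<^sup>2 = w + 1" using w by (metis add_eq_iff[OF char2] add.commute)
  have w0: "w \<noteq> 0" "w \<noteq> 1" using w by (auto simp: c2)
  have ww: "w * (w + 1) = 1" using w by (simp add: algebra_simps power2_eq_square)

  \<comment> \<open>Closure properties of the subfields and of \<open>S\<close>; bijectivity\<close>
  have Fq: "Fq = {x. x ^ (2 ^ k) = x}" and Fl: "Fl = {x. x ^ (2 ^ l) = x}"
    using subfield_order_eq_roots assms(7,8) by blast+
  have closed: "0 \<in> F \<and> 1 \<in> F \<and> (\<forall>x\<in>F. inverse x \<in> F \<and> (\<forall>y\<in>F. x + y \<in> F \<and> x * y \<in> F))"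
    if "F = {x. x ^ (2 ^ j) = x}" for F :: "'a set" and j
    by (auto simp: that pow_two_pow_add[OF char2] power_mult_distrib power_inverse power_0_left)
  note closed_q = closed[OF Fq] and closed_l = closed[OF Fl]
  have w_mem: "w ^ (2 ^ j) = w" if "even j" for j
  proof -
    have "w ^ 4 = w"
      using power_mult[of w 2 2] by (simp add: w2 pow2_add[OF char2] c2 add.commute)
    then have "w ^ (4 ^ i) = w" for i by (induction i) (simp_all add: power_mult)
    with that show ?thesis by (auto elim!: evenE simp: power_mult)
  qed
  have wq: "w \<in> Fq" using w_mem assms(3) by (simp add: Fq)

  have S1: "abs_trace n x = 1" "x / (1 + x) \<in> S1" if "x \<in> S1" for x using assms(9) that by auto
  have S_sub: "Fq - Fl \<subseteq> S" "S \<subseteq> S1 \<union> (Fq - Fl)" using assms(10) by auto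
  have "0 \<notin> S1" using S1(1)[of 0] by (auto simp: abs_trace_def power_0_left)
  moreover have "1 \<notin> S1" using S1(1)[of 1] abs_trace_1[OF char2 \<open>even n\<close>] by auto
  ultimately have S01: "0 \<notin> S" "1 \<notin> S" using S_sub(2) closed_l by auto
  \<comment> \<open>In characteristic 2 the map \<open>x / (1 + x)\<close> is an involution, so
    invariance in one direction gives the other.\<close>
  have mob_iff: "x / (1 + x) \<in> F \<longleftrightarrow> x \<in> F"
    if F: "F = {x. x ^ (2 ^ j) = x}" and x: "x \<noteq> 1" for F :: "'a set" and j x
  proof
    note cl = closed[OF F]
    show "x / (1 + x) \<in> F" if "x \<in> F" using cl that by (simp add: divide_inverse)
    have "1 + x \<noteq> 0" using x by (simp add: eq_iff)
    then have "1 + x / (1 + x) = (1 + (x + x)) / (1 + x)" by (simp add: field_simps)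
    then have "x = x / (1 + x) * inverse (1 + x / (1 + x))"
      using \<open>1 + x \<noteq> 0\<close> by (simp add: c2)
    then show "x \<in> F" if "x / (1 + x) \<in> F" using cl that by metis
  qed
  have S_mob: "x / (1 + x) \<in> S" if "x \<in> S" for x
  proof -
    have "x \<noteq> 1" using that S01 by auto
    then show ?thesis using assms(10) that S1(2) mob_iff[OF Fq, of x] mob_iff[OF Fl, of x] by auto
  qed
  have "inj ?f" using inj_inverse_add_indicator[OF char2 S01 S_mob] .
  then have bij: "bij ?f" by (simp add: bij_def finite_UNIV_inj_surj)

  \<comment> \<open>Triples whose inverses sum to 1\<close>
  have triple: "u \<notin> S1 \<and> (u \<in> Fq \<longrightarrow> v \<in> Fq)"
    if uv: "u \<noteq> 0" "v \<noteq> 0" "u \<noteq> v" "inverse u + inverse v + inverse (u + v) = 1" for u v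
  proof
    note t = triple_artin_schreier[OF char2 uv]
    have u: "1 + u \<noteq> 0" using t(1) by (simp add: eq_iff)
    have "abs_trace n (inverse (1 + u)) = 0"
      unfolding t(2) [symmetric] by (simp add: abs_trace_sq_add[OF char2] pow_n c2)
    \<comment> \<open>For even \<open>n\<close> the trace of 1 is 0, so \<open>u / (1 + u)\<close>
      has trace 0 too. If \<open>u\<close> were in \<open>S1\<close>, this quotient would be as well
      and have trace 1.\<close>
    moreover have "u / (1 + u) = 1 + inverse (1 + u)"
    proof -
      have "1 + inverse (1 + u) = (1 + (1 + u)) / (1 + u)" using u by (simp add: field_simps)
      then show ?thesis by (simp add: c2)
    qed
    ultimately have "abs_trace n (u / (1 + u)) = 0"
      by (simp add: abs_trace_add[OF char2] abs_trace_1[OF char2 \<open>even n\<close>])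
    then show "u \<notin> S1" using S1 by fastforce
    show "u \<in> Fq \<longrightarrow> v \<in> Fq"
    proof
      assume "u \<in> Fq"
      then have "inverse (1 + u) \<in> Fq" using closed_q by auto
      then have "((v / u)\<^sup>2 + v / u) ^ (2 ^ k) = (v / u)\<^sup>2 + v / u"
        unfolding t(2) by (simp only: Fq mem_Collect_eq)
      then have "(v / u) ^ (2 ^ k) = v / u"
        using nm(2) pow_km by (rule artin_schreier_root_in_subfield[OF char2])
      then have "v / u * u \<in> Fq" using closed_q \<open>u \<in> Fq\<close> by (simp only: Fq mem_Collect_eq)
      then show "v \<in> Fq" using uv by simp
    qed
  qed

  have key: "a \<in> S \<longleftrightarrow> ((x \<in> S) \<noteq> (x + a \<in> S))"
    if a: "a \<noteq> 0" "a \<noteq> 1" and x: "x \<noteq> 0" "x \<noteq> a"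
      and eq: "inverse (x + a) + inverse x + inverse a = 1"
      and aw: "a \<in> S \<longleftrightarrow> ((a * w \<in> S) \<noteq> (a * w + a \<in> S))" for a x
  proof -
    have xa: "x + a \<noteq> 0" using x by (simp add: eq_iff)
    have tax: "inverse a + inverse x + inverse (a + x) = 1" using eq by (simp add: add_ac)
    have "a \<notin> S1 \<and> (a \<in> Fq \<longrightarrow> x \<in> Fq)"
      using triple[of a x] a x tax by auto
    moreover have "x \<notin> S1 \<and> (x \<in> Fq \<longrightarrow> a \<in> Fq)"
      using triple[of x a] a x eq by (auto simp: add_ac)
    moreover have "x + a \<notin> S1 \<and> (x + a \<in> Fq \<longrightarrow> a \<in> Fq)"
    proof -
      have "x + a \<noteq> a" using x by simp
      moreover have "inverse (x + a) + inverse a + inverse (x + a + a) = 1"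
        using eq by (simp add: add_ac c2)
      ultimately show ?thesis using triple[of "x + a" a] a xa by auto
    qed
    \<comment> \<open>The members of the triple lie in \<open>Fq\<close> together or not at all, and
      none is in \<open>S1\<close>; only \<open>Fl\<close> distinguishes them.\<close>
    ultimately have tS: "t \<in> S \<longleftrightarrow> a \<in> Fq \<and> t \<notin> Fl" if "t \<in> {a, x, x + a}" for t
      using that S_sub closed_q by blast
    have split: "(x + a \<in> Fl) = (x \<in> Fl)" if "a \<in> Fl"
    proof
      assume "x + a \<in> Fl"
      then have "x + a + a \<in> Fl" using closed_l that by blast
      then show "x \<in> Fl" by (simp add: c2 add.assoc)
    qed (use closed_l that in blast)
    show ?thesis
    proof (cases "a \<in> Fq \<and> a \<notin> Fl")
      case False
      then show ?thesis using tS split by auto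
    next
      case True
      text \<open>Here \<open>a \<in> S\<close>, so by \<open>aw\<close> exactly one of \<open>a * w\<close>, \<open>a * w + a\<close> lies in \<open>S\<close>; the other
        one therefore lies in \<open>Fl\<close>. Every admissible \<open>l\<close> excludes this.\<close>
      then have "a \<in> S" using S_sub by blast
      have "a * w \<in> Fq" "a * w + a \<in> Fq" using True wq closed_q by auto
      with aw \<open>a \<in> S\<close> S_sub(1) have "a * w \<in> Fl \<or> a * w + a \<in> Fl" by blast
      \<comment> \<open>In either case \<open>a\<close> is an element of \<open>Fl\<close> times
        \<open>w\<close> or \<open>w + 1\<close>, both roots of \<open>t\<^sup>2 + t = 1\<close>;
        \<open>c\<close> and \<open>w'\<close> name the two factors.\<close>
      have a_w: "a = a * w * (w + 1)" using ww by (simp only: mult.assoc mult_1_right)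
      have "(a * w + a) * w = a * (w * (w + 1))" by (simp add: algebra_simps)
      then have a_w': "a = (a * w + a) * w" using ww by simp
      have "(w + 1)\<^sup>2 + (w + 1) = 1" using w by (simp add: pow2_add[OF char2] add_ac c2)
      then obtain w' c where w': "w'\<^sup>2 + w' = 1" and c: "c \<in> Fl" "a = c * w'"
        using \<open>a * w \<in> Fl \<or> a * w + a \<in> Fl\<close> a_w a_w' w by blast
      have "c \<noteq> 0" using c a by auto
      define y where "y = x / a"
      have y: "y\<^sup>2 + y = inverse (1 + a)"
        unfolding y_def using triple_artin_schreier[OF char2 a(1) x(1) _ tax] x by auto
      have "inverse (1 + a) \<in> Fq" using True closed_q by blast
      then have "(y\<^sup>2 + y) ^ (2 ^ k) = y\<^sup>2 + y"
        unfolding y by (simp only: Fq mem_Collect_eq)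
      then have "y ^ (2 ^ k) = y"
        using nm(2) pow_km by (rule artin_schreier_root_in_subfield[OF char2])
      from assms(11) have False
      proof (elim disjE conjE)
        assume "even l"
        have "w \<in> Fl" using w_mem \<open>even l\<close> by (simp add: Fl)
        then have "w + 1 \<in> Fl" using closed_l by auto
        then show False
          using \<open>a * w \<in> Fl \<or> a * w + a \<in> Fl\<close> \<open>w \<in> Fl\<close> closed_l True a_w a_w' by metis
      next
        \<comment> \<open>Here \<open>c = 1\<close>, so \<open>a = w'\<close> and
          \<open>inverse (1 + a) = w'\<close>; \<open>y\<close> would be a root of
          \<open>y\<^sup>2 + y = w'\<close> in a field of degree twice an odd number.\<close>
        assume "l = 1" "k mod 4 = 2"
        have "c * c = c" using c(1) \<open>l = 1\<close> by (simp add: Fl power2_eq_square)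
        then have "a = w'" using \<open>c \<noteq> 0\<close> c(2) by simp
        have "w' * (1 + w') = 1" using w' by (simp add: algebra_simps power2_eq_square)
        then have "inverse (1 + w') = w'" by (metis inverse_unique mult.commute)
        then have "y\<^sup>2 + y = w'" using y \<open>a = w'\<close> by simp
        moreover obtain j where "k = 2 * j" "odd j"
        proof
          show "k = 2 * (k div 2)" "odd (k div 2)" using \<open>k mod 4 = 2\<close> by presburger+
        qed
        ultimately show False
          using no_artin_schreier_root_omega[OF char2 w', of y j] \<open>y ^ (2 ^ k) = y\<close> by simp
      next
        assume "l = 3" "k = 6"
        then show False
          using no_artin_schreier_root_GF64[OF char2 w', of c y] c y \<open>c \<noteq> 0\<close> \<open>y ^ (2 ^ k) = y\<close>
          by (simp add: Fl)
      qed
      then show ?thesis ..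
    qed
  qed
  have le: "diff_count ?f a b \<le> 4" if "a \<noteq> 0" for a b
    by (rule diff_count_le_4[OF char2 w S01(1) that]) (use key that in blast)

  \<comment> \<open>The map \<open>x / (1 + x)\<close> swaps \<open>w\<close> and
    \<open>w + 1\<close>, so the indicator cancels on this pair. It also cancels on 0 and 1, both
    outside \<open>S\<close>, which gives four solutions for \<open>a = b = 1\<close>.\<close>
  have "w \<in> S \<longleftrightarrow> w + 1 \<in> S"
  proof -
    have "w + 1 \<noteq> 0" using w0 by (simp add: eq_iff)
    have "w / (1 + w) = w + 1"
      using \<open>w + 1 \<noteq> 0\<close> w2 ww by (simp add: field_simps c2 power2_eq_square)
    moreover have "(w + 1) / (1 + (w + 1)) = w"
      using w0 w2 by (simp add: field_simps c2 power2_eq_square)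
    ultimately show ?thesis using S_mob[of w] S_mob[of "w + 1"] by auto
  qed
  moreover have "inverse w = w + 1" "inverse (w + 1) = w"
    using ww by (metis inverse_unique, metis inverse_unique mult.commute)
  ultimately have "{0, 1, w, w + 1} \<subseteq> {x. ?f (x + 1) + ?f x = 1}"
    using S01 by (auto simp: indicator_def c2 add_ac)
  then have "card {0, 1, w, w + 1} \<le> diff_count ?f 1 1"
    unfolding diff_count_def by (intro card_mono) auto
  moreover have "card {0, 1, w, w + 1} = 4"
    using w0 by (simp add: card_insert_if eq_iff)
  ultimately have "diff_count ?f 1 1 = 4" using le[of 1 1] by simp
  moreover have "finite {diff_count ?f a b | a b. a \<noteq> 0}"
    by (rule finite_subset[of _ "{..4}"]) (use le in auto)
  ultimately have "diff_uniformity ?f = 4"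
    unfolding diff_uniformity_def using le by (intro Max_eqI) force+
  then show ?thesis using bij by (simp add: diff_4_uniform_def)
qed

end
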